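(* Let $G$ be a finite abelian group, written additively. For $h\in\operatorname{Aut}(G)$ and $x_0,y_0\in G$ let $t_{h,x_0,y_0}$ be the triple of maps $G\to G$ $$t_{h,x_0,y_0}=\bigl(x\mapsto h(x)+x_0,\; y\mapsto h(y)+y_0,\; z\mapsto h(z)+x_0+y_0\bigr),$$ which is an autotopism of $G$. Then the map $$\phi:\operatorname{Aut}(G)\ltimes G^2\to \operatorname{Atp}(G),\qquad (h,x_0,y_0)\mapsto t_{h,x_0,y_0}$$ is a group isomorphism, where the multiplication on $\operatorname{Aut}(G)\ltimes G^2$ is given by $$(h,X)(h',X')=(hh',\,hX'+X)\qquad (h,h'\in\operatorname{Aut}(G),\ X,X'\in G^2).$$
   Context: An autotopism of a group $(G,\cdot)$ is a triple $(\alpha,\beta,\gamma)$ of bijections $G\to G$ such that $\alpha(x)\cdot\beta(y)=\gamma(x\cdot y)$ for all $x,y\in G$. $\operatorname{Atp}(G)$ is the set of all autotopisms of $G$; it is a group under componentwise composition $(\alpha,\beta,\gamma)(\alpha',\beta',\gamma')=(\alpha\circ\alpha',\beta\circ\beta',\gamma\circ\gamma')$. $\operatorname{Aut}(G)$ is the group of automorphisms of $G$, acting on $G^2=G\times G$ componentwise: $h(x,y)=(h(x),h(y))$. *)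

theory Defs
  imports "HOL-Algebra.Bij"
begin

text \<open>
  As in \<^theory>\<open>HOL-Algebra.Bij\<close>, maps on the carrier are represented by functions that are
  extensional on it, so that equality of functions is equality on the carrier.
  Abelian groups are instances of the library's (multiplicatively written) \<^locale>\<open>comm_group\<close>.
\<close>

definition autotopisms :: "('a, 'b) monoid_scheme \<Rightarrow> (('a \<Rightarrow> 'a) \<times> ('a \<Rightarrow> 'a) \<times> ('a \<Rightarrow> 'a)) set"
  where "autotopisms G =
    {(\<alpha>, \<beta>, \<gamma>). \<alpha> \<in> Bij (carrier G) \<and> \<beta> \<in> Bij (carrier G) \<and> \<gamma> \<in> Bij (carrier G) \<and>
       (\<forall>x\<in>carrier G. \<forall>y\<in>carrier G. \<alpha> x \<otimes>\<^bsub>G\<^esub> \<beta> y = \<gamma> (x \<otimes>\<^bsub>G\<^esub> y))}"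

definition AtpGroup :: "('a, 'b) monoid_scheme \<Rightarrow> (('a \<Rightarrow> 'a) \<times> ('a \<Rightarrow> 'a) \<times> ('a \<Rightarrow> 'a)) monoid"
  where "AtpGroup G =
    (BijGroup (carrier G) \<times>\<times> BijGroup (carrier G) \<times>\<times> BijGroup (carrier G))
      \<lparr>carrier := autotopisms G\<rparr>"

text \<open>
  The semidirect product of \<open>Aut(G)\<close> and \<open>G\<^sup>2\<close>. The \<open>G\<^sup>2\<close>-component of a product is
  \<open>h X' + X\<close> in additive notation, with \<open>h\<close> acting componentwise.
\<close>
definition AutSemidirectSquare :: "('a, 'b) monoid_scheme \<Rightarrow> (('a \<Rightarrow> 'a) \<times> 'a \<times> 'a) monoid"
  where "AutSemidirectSquare G =
    \<lparr>carrier = carrier (AutoGroup G) \<times> carrier (G \<times>\<times> G),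
     mult = (\<lambda>(h, X) (h', X').
       (h \<otimes>\<^bsub>AutoGroup G\<^esub> h', map_prod h h X' \<otimes>\<^bsub>G \<times>\<times> G\<^esub> X)),
     one = (\<one>\<^bsub>AutoGroup G\<^esub>, \<one>\<^bsub>G \<times>\<times> G\<^esub>)\<rparr>"

definition affine_triple ::
    "('a, 'b) monoid_scheme \<Rightarrow> ('a \<Rightarrow> 'a) \<Rightarrow> 'a \<Rightarrow> 'a \<Rightarrow> ('a \<Rightarrow> 'a) \<times> ('a \<Rightarrow> 'a) \<times> ('a \<Rightarrow> 'a)"
  where "affine_triple G h x\<^sub>0 y\<^sub>0 =
    (\<lambda>x\<in>carrier G. h x \<otimes>\<^bsub>G\<^esub> x\<^sub>0,
     \<lambda>y\<in>carrier G. h y \<otimes>\<^bsub>G\<^esub> y\<^sub>0,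
     \<lambda>z\<in>carrier G. h z \<otimes>\<^bsub>G\<^esub> x\<^sub>0 \<otimes>\<^bsub>G\<^esub> y\<^sub>0)"

end

theory Submission
  imports Defs
begin

text \<open>
  An autotopism \<open>(\<alpha>, \<beta>, \<gamma>)\<close> is determined by \<open>\<alpha>\<close> and \<open>y\<^sub>0 = \<beta> 0\<close>: putting \<open>y = 0\<close> gives
  \<open>\<gamma> x = \<alpha> x + y\<^sub>0\<close>, and putting \<open>x = 0\<close> gives \<open>\<gamma> y = x\<^sub>0 + \<beta> y\<close> with \<open>x\<^sub>0 = \<alpha> 0\<close>.
  Subtracting \<open>x\<^sub>0 + y\<^sub>0\<close> from \<open>\<alpha> x + \<beta> y = \<gamma> (x + y)\<close> shows that \<open>x \<mapsto> \<alpha> x - x\<^sub>0\<close> is an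
  automorphism, which yields surjectivity.
\<close>

section \<open>Membership and multiplication in the groups involved\<close>

lemma autotopismsI:
  assumes "\<alpha> \<in> Bij (carrier G)" "\<beta> \<in> Bij (carrier G)" "\<gamma> \<in> Bij (carrier G)"
    and "\<And>x y. x \<in> carrier G \<Longrightarrow> y \<in> carrier G \<Longrightarrow> \<alpha> x \<otimes>\<^bsub>G\<^esub> \<beta> y = \<gamma> (x \<otimes>\<^bsub>G\<^esub> y)"
  shows "(\<alpha>, \<beta>, \<gamma>) \<in> autotopisms G"
  using assms by (simp add: autotopisms_def)

lemma autotopismsD:
  assumes "(\<alpha>, \<beta>, \<gamma>) \<in> autotopisms G"
  shows "\<alpha> \<in> Bij (carrier G)" "\<beta> \<in> Bij (carrier G)" "\<gamma> \<in> Bij (carrier G)"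
    and "\<And>x y. x \<in> carrier G \<Longrightarrow> y \<in> carrier G \<Longrightarrow> \<alpha> x \<otimes>\<^bsub>G\<^esub> \<beta> y = \<gamma> (x \<otimes>\<^bsub>G\<^esub> y)"
  using assms by (simp_all add: autotopisms_def)

lemma Bij_closed: "f \<in> Bij S \<Longrightarrow> x \<in> S \<Longrightarrow> f x \<in> S"
  using Bij_imp_funcset by blast

text \<open>The multiplication of \<open>BijGroup\<close> is itself a restricted function, equal to
  \<open>compose\<close> only on arguments in \<open>Bij\<close>. Membership of both triples is what
  allows it to be unfolded; the same applies to \<open>mult_AutoGroup\<close>.\<close>

lemma mult_AtpGroup:
  assumes "(\<alpha>, \<beta>, \<gamma>) \<in> autotopisms G" "(\<alpha>', \<beta>', \<gamma>') \<in> autotopisms G"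
  shows "(\<alpha>, \<beta>, \<gamma>) \<otimes>\<^bsub>AtpGroup G\<^esub> (\<alpha>', \<beta>', \<gamma>') =
    (compose (carrier G) \<alpha> \<alpha>', compose (carrier G) \<beta> \<beta>', compose (carrier G) \<gamma> \<gamma>')"
  using assms[THEN autotopismsD(1)] assms[THEN autotopismsD(2)] assms[THEN autotopismsD(3)]
  by (simp add: AtpGroup_def BijGroup_def)

lemma carrier_AtpGroup: "carrier (AtpGroup G) = autotopisms G"
  by (simp add: AtpGroup_def)

lemma carrier_AutoGroup: "carrier (AutoGroup G) = auto G"
  by (simp add: AutoGroup_def)

lemma one_AutoGroup: "\<one>\<^bsub>AutoGroup G\<^esub> = (\<lambda>x\<in>carrier G. x)"
  by (simp add: AutoGroup_def BijGroup_def)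

lemma mult_AutoGroup:
  "h \<in> auto G \<Longrightarrow> h' \<in> auto G \<Longrightarrow> h \<otimes>\<^bsub>AutoGroup G\<^esub> h' = compose (carrier G) h h'"
  by (simp add: AutoGroup_def BijGroup_def auto_def)

lemma auto_Bij: "h \<in> auto G \<Longrightarrow> h \<in> Bij (carrier G)"
  by (simp add: auto_def)

lemma auto_closed: "h \<in> auto G \<Longrightarrow> x \<in> carrier G \<Longrightarrow> h x \<in> carrier G"
  by (simp add: auto_Bij Bij_closed)

lemma auto_mult:
  "h \<in> auto G \<Longrightarrow> x \<in> carrier G \<Longrightarrow> y \<in> carrier G \<Longrightarrow> h (x \<otimes>\<^bsub>G\<^esub> y) = h x \<otimes>\<^bsub>G\<^esub> h y"
  by (simp add: auto_def hom_mult)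

lemma carrier_AutSemidirectSquare:
  "carrier (AutSemidirectSquare G) = auto G \<times> carrier G \<times> carrier G"
  by (simp add: AutSemidirectSquare_def carrier_AutoGroup)

lemma mult_AutSemidirectSquare:
  assumes "h \<in> auto G" "h' \<in> auto G"
  shows "(h, x, y) \<otimes>\<^bsub>AutSemidirectSquare G\<^esub> (h', x', y') =
    (compose (carrier G) h h', h x' \<otimes>\<^bsub>G\<^esub> x, h y' \<otimes>\<^bsub>G\<^esub> y)"
  using assms by (simp add: AutSemidirectSquare_def mult_AutoGroup)

lemma one_AutSemidirectSquare:
  "\<one>\<^bsub>AutSemidirectSquare G\<^esub> = (\<lambda>x\<in>carrier G. x, \<one>\<^bsub>G\<^esub>, \<one>\<^bsub>G\<^esub>)"
  by (simp add: AutSemidirectSquare_def one_AutoGroup)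

section \<open>Autotopisms form a group\<close>

context group
begin

lemma compose_autotopisms:
  assumes "(\<alpha>, \<beta>, \<gamma>) \<in> autotopisms G" "(\<alpha>', \<beta>', \<gamma>') \<in> autotopisms G"
  shows "(compose (carrier G) \<alpha> \<alpha>', compose (carrier G) \<beta> \<beta>', compose (carrier G) \<gamma> \<gamma>')
    \<in> autotopisms G"
  using autotopismsD[OF assms(1)] autotopismsD[OF assms(2)]
  by (intro autotopismsI) (simp_all add: compose_Bij compose_eq Bij_closed)

text \<open>Every pair of arguments has the form x = \<alpha> a, y = \<beta> b, and then the product
  of x and y is \<gamma> of the product of a and b. Reading this backwards is the autotopism
  equation for the inverses. The restrictions give the inverses the form they have in
  \<open>BijGroup\<close>.\<close>

lemma inv_autotopisms:
  assumes "(\<alpha>, \<beta>, \<gamma>) \<in> autotopisms G"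
  shows "(\<lambda>x\<in>carrier G. inv_into (carrier G) \<alpha> x,
          \<lambda>x\<in>carrier G. inv_into (carrier G) \<beta> x,
          \<lambda>x\<in>carrier G. inv_into (carrier G) \<gamma> x) \<in> autotopisms G"
proof (rule autotopismsI)
  note atp = autotopismsD[OF assms]
  have bij: "bij_betw \<alpha> (carrier G) (carrier G)" "bij_betw \<beta> (carrier G) (carrier G)"
    "bij_betw \<gamma> (carrier G) (carrier G)"
    using atp(1-3) by (simp_all add: Bij_def)
  fix x y assume x: "x \<in> carrier G" and y: "y \<in> carrier G"
  obtain a b where a: "a \<in> carrier G" "x = \<alpha> a" and b: "b \<in> carrier G" "y = \<beta> b"
    using x y bij(1,2) by (metis bij_betw_imp_surj_on imageE)
  then have "x \<otimes> y = \<gamma> (a \<otimes> b)"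
    by (simp add: atp(4))
  then show "restrict (inv_into (carrier G) \<alpha>) (carrier G) x \<otimes>
      restrict (inv_into (carrier G) \<beta>) (carrier G) y =
      restrict (inv_into (carrier G) \<gamma>) (carrier G) (x \<otimes> y)"
    using x y a b bij m_closed[OF x y] by (auto simp: bij_betw_inv_into_left)
qed (use autotopismsD[OF assms] in \<open>simp_all add: restrict_inv_into_Bij\<close>)

text \<open>\<open>AtpGroup\<close> is a direct product of three copies of \<open>BijGroup\<close>
  with a smaller carrier, so it is enough that this carrier is a subgroup.\<close>

lemma group_AtpGroup: "group (AtpGroup G)"
proof -
  let ?B = "BijGroup (carrier G)"
  have B: "group (?B \<times>\<times> ?B)" "group (?B \<times>\<times> ?B \<times>\<times> ?B)"
    by (simp_all add: DirProd_group group_BijGroup)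
  interpret B: group "?B \<times>\<times> ?B \<times>\<times> ?B" by (rule B(2))
  have "subgroup (autotopisms G) (?B \<times>\<times> ?B \<times>\<times> ?B)"
  proof (rule B.subgroupI)
    show "autotopisms G \<subseteq> carrier (?B \<times>\<times> ?B \<times>\<times> ?B)"
      by (auto simp: autotopisms_def BijGroup_def)
    have "(\<lambda>x\<in>carrier G. x, \<lambda>x\<in>carrier G. x, \<lambda>x\<in>carrier G. x) \<in> autotopisms G"
      by (rule autotopismsI) (simp_all add: id_Bij)
    then show "autotopisms G \<noteq> {}"
      by blast
  next
    fix t assume "t \<in> autotopisms G"
    then obtain \<alpha> \<beta> \<gamma> where t: "t = (\<alpha>, \<beta>, \<gamma>)" and atp: "(\<alpha>, \<beta>, \<gamma>) \<in> autotopisms G"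
      by (cases t) auto
    have "\<alpha> \<in> carrier ?B" "\<beta> \<in> carrier ?B" "\<gamma> \<in> carrier ?B"
      using autotopismsD(1-3)[OF atp] by (simp_all add: BijGroup_def)
    \<comment> \<open>The triple product is nested to the right, so the inverse is split twice:
      \<alpha> from the pair of \<beta> and \<gamma>, then \<beta> from \<gamma>.\<close>
    then have "inv\<^bsub>?B \<times>\<times> ?B \<times>\<times> ?B\<^esub> t = (inv\<^bsub>?B\<^esub> \<alpha>, inv\<^bsub>?B\<^esub> \<beta>, inv\<^bsub>?B\<^esub> \<gamma>)"
      using inv_DirProd[OF group_BijGroup B(1), of \<alpha> "carrier G" "(\<beta>, \<gamma>)"]
        inv_DirProd[OF group_BijGroup group_BijGroup, of \<beta> "carrier G" \<gamma> "carrier G"]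
      by (simp only: t carrier_DirProd mem_Sigma_iff simp_thms)
    then show "inv\<^bsub>?B \<times>\<times> ?B \<times>\<times> ?B\<^esub> t \<in> autotopisms G"
      using inv_autotopisms[OF atp] autotopismsD(1-3)[OF atp] by (simp add: inv_BijGroup)
  next
    fix t t' assume atp: "t \<in> autotopisms G" "t' \<in> autotopisms G"
    obtain \<alpha> \<beta> \<gamma> \<alpha>' \<beta>' \<gamma>' where t: "t = (\<alpha>, \<beta>, \<gamma>)" "t' = (\<alpha>', \<beta>', \<gamma>')"
      by (metis prod_cases3)
    \<comment> \<open>Changing the carrier leaves the multiplication as it was, so closure can be
      checked in \<open>AtpGroup\<close>, where the product is known.\<close>
    have "t \<otimes>\<^bsub>AtpGroup G\<^esub> t' \<in> autotopisms G"
      using compose_autotopisms[OF atp[unfolded t]] mult_AtpGroup[OF atp[unfolded t]]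
      by (simp only: t)
    then show "t \<otimes>\<^bsub>?B \<times>\<times> ?B \<times>\<times> ?B\<^esub> t' \<in> autotopisms G"
      by (simp add: AtpGroup_def)
  qed
  then show ?thesis
    unfolding AtpGroup_def by (rule B.subgroup_imp_group)
qed

section \<open>The semidirect product is a group\<close>

lemma auto_one: "h \<in> auto G \<Longrightarrow> h \<one> = \<one>"
  by (simp add: auto_def hom_one)

lemma compose_auto: "h \<in> auto G \<Longrightarrow> h' \<in> auto G \<Longrightarrow> compose (carrier G) h h' \<in> auto G"
  using subgroup.m_closed[OF subgroup_auto, of h h']
  by (simp add: BijGroup_def auto_Bij)

text \<open>For associativity, both bracketings of (h, X)(h', X')(h'', X'') have second component
  h(h' X'') + h X' + X, with the summands in this order.\<close>

lemma group_AutSemidirectSquare: "group (AutSemidirectSquare G)"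
proof (rule groupI)
  fix s t assume "s \<in> carrier (AutSemidirectSquare G)" "t \<in> carrier (AutSemidirectSquare G)"
  then show "s \<otimes>\<^bsub>AutSemidirectSquare G\<^esub> t \<in> carrier (AutSemidirectSquare G)"
    by (auto simp: carrier_AutSemidirectSquare mult_AutSemidirectSquare compose_auto auto_closed)
next
  show "\<one>\<^bsub>AutSemidirectSquare G\<^esub> \<in> carrier (AutSemidirectSquare G)"
    by (simp add: carrier_AutSemidirectSquare one_AutSemidirectSquare id_in_auto)
next
  fix s t u
  assume "s \<in> carrier (AutSemidirectSquare G)" "t \<in> carrier (AutSemidirectSquare G)"
    "u \<in> carrier (AutSemidirectSquare G)"
  then show "s \<otimes>\<^bsub>AutSemidirectSquare G\<^esub> t \<otimes>\<^bsub>AutSemidirectSquare G\<^esub> u =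
      s \<otimes>\<^bsub>AutSemidirectSquare G\<^esub> (t \<otimes>\<^bsub>AutSemidirectSquare G\<^esub> u)"
    by (auto simp: carrier_AutSemidirectSquare mult_AutSemidirectSquare compose_auto auto_closed
        auto_mult compose_eq m_assoc compose_assoc[symmetric] auto_Bij Bij_imp_funcset)
next
  fix s assume "s \<in> carrier (AutSemidirectSquare G)"
  then show "\<one>\<^bsub>AutSemidirectSquare G\<^esub> \<otimes>\<^bsub>AutSemidirectSquare G\<^esub> s = s"
    by (auto simp: carrier_AutSemidirectSquare mult_AutSemidirectSquare one_AutSemidirectSquare
        id_in_auto auto_Bij Bij_imp_funcset Bij_imp_extensional)
next
  fix s assume s: "s \<in> carrier (AutSemidirectSquare G)"
  then obtain h x y where s_eq: "s = (h, x, y)" and h: "h \<in> auto G"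
    and x: "x \<in> carrier G" and y: "y \<in> carrier G"
    by (auto simp: carrier_AutSemidirectSquare)
  obtain k where k: "k \<in> auto G" and kh: "compose (carrier G) k h = (\<lambda>x\<in>carrier G. x)"
    using group.l_inv_ex[OF AutoGroup, of h] h
    by (auto simp: carrier_AutoGroup one_AutoGroup mult_AutoGroup)
  \<comment> \<open>With k a left inverse of h, the first coordinate of the square part is
    \<open>k x \<otimes> k (inv x)\<close>, which \<open>auto_mult\<close> read from right to left
    collapses to \<open>k \<one>\<close>; likewise for y.\<close>
  have "(k, k (inv x), k (inv y)) \<otimes>\<^bsub>AutSemidirectSquare G\<^esub> s = \<one>\<^bsub>AutSemidirectSquare G\<^esub>"
    using h k x y
    by (simp add: s_eq mult_AutSemidirectSquare one_AutSemidirectSquare kh auto_one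
        flip: auto_mult)
  then show "\<exists>t\<in>carrier (AutSemidirectSquare G). t \<otimes>\<^bsub>AutSemidirectSquare G\<^esub> s =
      \<one>\<^bsub>AutSemidirectSquare G\<^esub>"
    using k x y by (force simp: carrier_AutSemidirectSquare auto_closed)
qed

section \<open>Affine triples and the isomorphism\<close>

lemma translate_Bij:
  assumes h: "h \<in> Bij (carrier G)" and c: "c \<in> carrier G"
  shows "(\<lambda>x\<in>carrier G. h x \<otimes> c) \<in> Bij (carrier G)"
proof -
  have "bij_betw (\<lambda>y. y \<otimes> c) (carrier G) (carrier G)"
    by (rule bij_betwI[where g = "\<lambda>y. y \<otimes> inv c"]) (use c in \<open>auto simp: m_assoc\<close>)
  moreover have "bij_betw h (carrier G) (carrier G)"
    using h by (simp add: Bij_def)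
  ultimately have "bij_betw (\<lambda>x. h x \<otimes> c) (carrier G) (carrier G)"
    using bij_betw_trans[unfolded comp_def] by blast
  then show ?thesis
    by (simp add: Bij_def)
qed

end

context comm_group
begin

lemma affine_triple_autotopism:
  assumes "h \<in> auto G" "x \<in> carrier G" "y \<in> carrier G"
  shows "affine_triple G h x y \<in> autotopisms G"
proof -
  \<comment> \<open>Reassociating turns the third component into a single translation, to which
    \<open>translate_Bij\<close> applies.\<close>
  have "(\<lambda>z\<in>carrier G. h z \<otimes> x \<otimes> y) = (\<lambda>z\<in>carrier G. h z \<otimes> (x \<otimes> y))"
    using assms by (auto simp: m_assoc auto_closed)
  then have "(\<lambda>z\<in>carrier G. h z \<otimes> x \<otimes> y) \<in> Bij (carrier G)"
    using assms translate_Bij[of h "x \<otimes> y"] by (simp add: auto_Bij)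
  then show ?thesis
    unfolding affine_triple_def using assms
    by (intro autotopismsI) (simp_all add: translate_Bij auto_Bij auto_closed auto_mult m_ac)
qed

text \<open>Composing the affine maps gives h(h' u + x') + x = h(h' u) + (h x' + x), which is the
  twisted rule of the semidirect product. In the third component commutativity regroups the four
  constants.\<close>

lemma affine_triple_mult:
  assumes "h \<in> auto G" "x \<in> carrier G" "y \<in> carrier G"
    and "h' \<in> auto G" "x' \<in> carrier G" "y' \<in> carrier G"
  shows "affine_triple G (compose (carrier G) h h') (h x' \<otimes> x) (h y' \<otimes> y) =
    affine_triple G h x y \<otimes>\<^bsub>AtpGroup G\<^esub> affine_triple G h' x' y'"
proof -
  have "affine_triple G h x y \<otimes>\<^bsub>AtpGroup G\<^esub> affine_triple G h' x' y' =
    (compose (carrier G) (\<lambda>u\<in>carrier G. h u \<otimes> x) (\<lambda>u\<in>carrier G. h' u \<otimes> x'),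
     compose (carrier G) (\<lambda>u\<in>carrier G. h u \<otimes> y) (\<lambda>u\<in>carrier G. h' u \<otimes> y'),
     compose (carrier G) (\<lambda>u\<in>carrier G. h u \<otimes> x \<otimes> y) (\<lambda>u\<in>carrier G. h' u \<otimes> x' \<otimes> y'))"
    using affine_triple_autotopism[OF assms(1-3)] affine_triple_autotopism[OF assms(4-6)]
    unfolding affine_triple_def by (rule mult_AtpGroup)
  also have "\<dots> = affine_triple G (compose (carrier G) h h') (h x' \<otimes> x) (h y' \<otimes> y)"
    unfolding affine_triple_def using assms
    by (auto simp: compose_def fun_eq_iff auto_closed auto_mult m_ac)
  finally show ?thesis ..
qed

text \<open>Automorphisms fix \<open>\<one>\<close>, so evaluating the first two components there
  returns x and y. Cancelling x then recovers h on the carrier, and extensionality makes this an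
  equality of functions.\<close>

lemma affine_triple_inj:
  assumes "h \<in> auto G" "x \<in> carrier G" "y \<in> carrier G"
    and "h' \<in> auto G" "x' \<in> carrier G" "y' \<in> carrier G"
    and "affine_triple G h x y = affine_triple G h' x' y'"
  shows "h = h' \<and> x = x' \<and> y = y'"
proof -
  have eq: "h u \<otimes> x = h' u \<otimes> x'" "h u \<otimes> y = h' u \<otimes> y'" if "u \<in> carrier G" for u
    using assms(7) that by (auto simp: affine_triple_def dest!: fun_cong[where x = u])
  have xy: "x = x'" "y = y'"
    using eq[OF one_closed] assms by (simp_all add: auto_one)
  have "h = h'"
  proof (rule extensionalityI)
    show "h \<in> extensional (carrier G)" "h' \<in> extensional (carrier G)"
      using assms by (simp_all add: auto_Bij Bij_imp_extensional)
    show "h u = h' u" if "u \<in> carrier G" for u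
      using eq(1)[OF that] that assms by (simp add: xy auto_closed)
  qed
  with xy show ?thesis by simp
qed

lemma autotopism_affine:
  assumes "(\<alpha>, \<beta>, \<gamma>) \<in> autotopisms G"
  obtains h x y where "h \<in> auto G" "x \<in> carrier G" "y \<in> carrier G"
    "affine_triple G h x y = (\<alpha>, \<beta>, \<gamma>)"
proof
  note atp = autotopismsD[OF assms]
  note closed = atp(1-3)[THEN Bij_closed]
  \<comment> \<open>This is \<alpha> translated so as to fix \<open>\<one>\<close>. The other two
    witnesses are \<open>\<alpha> \<one>\<close> and \<open>\<beta> \<one>\<close>.\<close>
  define h where "h = (\<lambda>u\<in>carrier G. \<alpha> u \<otimes> inv (\<alpha> \<one>))"
  have \<gamma>_\<alpha>: "\<gamma> u = \<alpha> u \<otimes> \<beta> \<one>" and \<gamma>_\<beta>: "\<gamma> u = \<alpha> \<one> \<otimes> \<beta> u" if "u \<in> carrier G" for u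
    using atp(4)[of u \<one>] atp(4)[of \<one> u] that by simp_all
  have \<alpha>_h: "\<alpha> u = h u \<otimes> \<alpha> \<one>" and h_closed: "h u \<in> carrier G" if "u \<in> carrier G" for u
    using that by (simp_all add: h_def m_assoc closed)
  have \<beta>_h: "\<beta> u = h u \<otimes> \<beta> \<one>" if "u \<in> carrier G" for u
  proof -
    \<comment> \<open>Both sides equal \<open>\<gamma> u\<close>, by the two formulas for \<gamma>;
      cancelling \<open>\<alpha> \<one>\<close> shows that \<beta> has the same linear part h as
      \<alpha>.\<close>
    have "\<alpha> \<one> \<otimes> \<beta> u = \<alpha> \<one> \<otimes> (h u \<otimes> \<beta> \<one>)"
      using \<gamma>_\<alpha>[OF that] \<gamma>_\<beta>[OF that] that by (simp add: \<alpha>_h[of u] m_ac closed h_closed)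
    then show ?thesis
      using that by (simp add: closed h_closed)
  qed
  have h_mult: "h (u \<otimes> v) = h u \<otimes> h v" if "u \<in> carrier G" "v \<in> carrier G" for u v
  proof -
    have "h (u \<otimes> v) \<otimes> (\<alpha> \<one> \<otimes> \<beta> \<one>) = \<gamma> (u \<otimes> v)"
      using that \<gamma>_\<alpha>[of "u \<otimes> v"] \<alpha>_h[of "u \<otimes> v"] by (simp add: m_assoc closed h_closed)
    also have "\<dots> = \<alpha> u \<otimes> \<beta> v"
      using that by (simp add: atp(4))
    also have "\<dots> = (h u \<otimes> h v) \<otimes> (\<alpha> \<one> \<otimes> \<beta> \<one>)"
      \<comment> \<open>As simplification rules, \<open>\<alpha>_h\<close> and
        \<open>\<beta>_h\<close> would rewrite the values at \<open>\<one>\<close> on their own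
        right-hand sides forever; \<open>subst\<close> applies each of them once.\<close>
      using that by (subst \<alpha>_h, simp, subst \<beta>_h) (simp_all add: m_ac closed h_closed)
    finally show ?thesis
      using that by (simp add: closed h_closed)
  qed
  have "h \<in> Bij (carrier G)"
    unfolding h_def by (rule translate_Bij) (simp_all add: atp(1) closed)
  with h_mult show "h \<in> auto G"
    by (auto simp: auto_def hom_def h_closed)
  show "\<alpha> \<one> \<in> carrier G" "\<beta> \<one> \<in> carrier G"
    by (simp_all add: closed)
  \<comment> \<open>The formulas above hold on the carrier only. Members of \<open>Bij\<close> are
    extensional, which lifts them to equalities of functions.\<close>
  have "(\<lambda>u\<in>carrier G. h u \<otimes> \<alpha> \<one>) = \<alpha>"
    by (rule extensionalityI[of _ "carrier G"]) (simp_all add: atp Bij_imp_extensional flip: \<alpha>_h)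
  moreover have "(\<lambda>u\<in>carrier G. h u \<otimes> \<beta> \<one>) = \<beta>"
    by (rule extensionalityI[of _ "carrier G"]) (simp_all add: atp Bij_imp_extensional flip: \<beta>_h)
  moreover have "(\<lambda>u\<in>carrier G. h u \<otimes> \<alpha> \<one> \<otimes> \<beta> \<one>) = \<gamma>"
    by (rule extensionalityI[of _ "carrier G"])
      (simp_all add: atp(3) Bij_imp_extensional \<gamma>_\<alpha> flip: \<alpha>_h)
  ultimately show "affine_triple G h (\<alpha> \<one>) (\<beta> \<one>) = (\<alpha>, \<beta>, \<gamma>)"
    by (simp add: affine_triple_def)
qed

lemma affine_triple_iso:
  "(\<lambda>(h, x, y). affine_triple G h x y) \<in> iso (AutSemidirectSquare G) (AtpGroup G)"
    (is "?\<phi> \<in> _")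
proof (rule isoI)
  show "?\<phi> \<in> hom (AutSemidirectSquare G) (AtpGroup G)"
    by (rule homI)
      (auto simp: carrier_AutSemidirectSquare carrier_AtpGroup mult_AutSemidirectSquare
        affine_triple_autotopism affine_triple_mult)
  show "bij_betw ?\<phi> (carrier (AutSemidirectSquare G)) (carrier (AtpGroup G))"
    unfolding bij_betw_def carrier_AutSemidirectSquare carrier_AtpGroup
  proof
    show "inj_on ?\<phi> (auto G \<times> carrier G \<times> carrier G)"
      by (rule inj_onI) (use affine_triple_inj in auto)
    show "?\<phi> ` (auto G \<times> carrier G \<times> carrier G) = autotopisms G"
    proof (intro equalityI subsetI)
      fix t assume "t \<in> autotopisms G"
      then obtain h x y where "h \<in> auto G" "x \<in> carrier G" "y \<in> carrier G"
        "affine_triple G h x y = t"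
        by (metis autotopism_affine prod_cases3)
      then show "t \<in> ?\<phi> ` (auto G \<times> carrier G \<times> carrier G)"
        by force
    qed (auto simp: affine_triple_autotopism)
  qed
qed

end

theorem proposition2p1:
  fixes G :: "('a, 'b) monoid_scheme"
  assumes "comm_group G" and "finite (carrier G)"
  shows "(\<forall>h\<in>carrier (AutoGroup G). \<forall>x\<^sub>0\<in>carrier G. \<forall>y\<^sub>0\<in>carrier G.
           affine_triple G h x\<^sub>0 y\<^sub>0 \<in> autotopisms G)
       \<and> group (AutSemidirectSquare G)
       \<and> group (AtpGroup G)
       \<and> (\<lambda>(h, x\<^sub>0, y\<^sub>0). affine_triple G h x\<^sub>0 y\<^sub>0) \<in> iso (AutSemidirectSquare G) (AtpGroup G)"
proof -
  interpret comm_group G by (rule assms(1))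
  show ?thesis
    by (simp add: carrier_AutoGroup affine_triple_autotopism group_AutSemidirectSquare
        group_AtpGroup affine_triple_iso)
qed

end
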